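(* For all $u\in\mathbb R^{\mathbb N}$, $$K^s_u=\inf_{(h,\beta)\in\Gamma^{\mathrm{dec}}_{\mathrm{ev}}(u)}\ \inf_{\substack{k\in\mathcal S(u,h)\\ k\ge\mathfrak m(h,\beta)}}\mathfrak F_u(k,h,\beta)=\inf_{(h,\beta)\in\Gamma^{\mathrm{dec}}_{\mathrm{ev}}(u)}\ \inf_{\substack{k\in\mathcal S(u,h)\\ k\ge\mathfrak m(h,\beta)}}\frac{\ln(h_k^{-1}(u_k))}{\ln(\beta_k)},$$ and the $\inf$ can be replaced by $\min$ when $R^s_u\neq\emptyset$.
   Context: $\mathbb N=\{0,1,2,\dots\}$; $\inf\emptyset=+\infty$. For $u=(u_k)_{k\in\mathbb N}\in\mathbb R^{\mathbb N}$: $R^s_u:=\{k\in\mathbb N: u_k>\limsup_{n\to+\infty}u_n\}$, $\Delta^s_u:=\{k\in\mathbb N:\max_{0\le j\le k}u_j>\sup_{j>k}u_j\}$, $K^s_u:=\inf\Delta^s_u$. $\Omega([0,1])$ is the set of functions $f:\mathbb R\to\mathbb R$ strictly increasing and continuous on $[0,1]$; $f^{-1}:[f(0),f(1)]\to[0,1]$ denotes the inverse of $f$ restricted to $[0,1]$. $\Gamma(u):=\{(h,\beta)\in\Omega([0,1])^{\mathbb N}\times(0,1)^{\mathbb N}: u_k\le h_k(\beta_k^k)\ \forall k\in\mathbb N\}$, where $\beta_k^k$ is the $k$-th power of $\beta_k$. $\mathcal S(u,h):=\{k\in\mathbb N: u_k>h_k(0)\}$. For $f,g\in\Omega([0,1])$,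 $f\le g$ means $f(x)\le g(x)$ for all $x\in[0,1]$; $(f,\beta)\le(g,\gamma)$ means $f\le g$ and $\beta\le\gamma$. $\Gamma^{\mathrm{dec}}_{\mathrm{ev}}(u)$ is the set of $(h,\beta)\in\Gamma(u)$ for which there is $N\in\mathbb N$ with $(h_{n+1},\beta_{n+1})\le(h_n,\beta_n)$ for all $n\ge N$; $\mathfrak m(h,\beta)$ is the smallest such $N$. The upper bound functional is $\mathfrak F_u(k,h,\beta):=\ln(h_k^{-1}(u_k))/\ln(\beta_k)$ if $(h,\beta)\in\Gamma(u)$ and $u_k>h_k(0)$, and $\mathfrak F_u(k,h,\beta):=+\infty$ otherwise. *)

theory Defs
  imports Complex_Main "HOL-Library.Extended_Real"
begin

(* Limsups, suprema and infima are taken in ereal, so that an unbounded sequence has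
   supremum +infinity and the infimum of the empty set is +infinity. *)

definition Rs :: "(nat \<Rightarrow> real) \<Rightarrow> nat set" where
  "Rs u = {k. ereal (u k) > limsup (\<lambda>n. ereal (u n))}"

definition Deltas :: "(nat \<Rightarrow> real) \<Rightarrow> nat set" where
  "Deltas u = {k. ereal (Max (u ` {0..k})) > (SUP j\<in>{k<..}. ereal (u j))}"

definition Ks :: "(nat \<Rightarrow> real) \<Rightarrow> ereal" where
  "Ks u = (INF k\<in>Deltas u. ereal (real k))"

definition Omega :: "(real \<Rightarrow> real) set" where
  "Omega = {f. strict_mono_on {0..1} f \<and> continuous_on {0..1} f}"

(* Meaningful only for arguments in the interval from f 0 to f 1. *)
definition Omega_inv :: "(real \<Rightarrow> real) \<Rightarrow> real \<Rightarrow> real" where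
  "Omega_inv f = the_inv_into {0..1} f"

definition Gamma :: "(nat \<Rightarrow> real) \<Rightarrow> ((nat \<Rightarrow> real \<Rightarrow> real) \<times> (nat \<Rightarrow> real)) set" where
  "Gamma u = {(h, \<beta>). (\<forall>k. h k \<in> Omega) \<and> (\<forall>k. \<beta> k \<in> {0<..<1}) \<and> (\<forall>k. u k \<le> h k (\<beta> k ^ k))}"

definition Sset :: "(nat \<Rightarrow> real) \<Rightarrow> (nat \<Rightarrow> real \<Rightarrow> real) \<Rightarrow> nat set" where
  "Sset u h = {k. u k > h k 0}"

definition pair_le :: "(real \<Rightarrow> real) \<times> real \<Rightarrow> (real \<Rightarrow> real) \<times> real \<Rightarrow> bool" where
  "pair_le p q \<longleftrightarrow> (\<forall>x\<in>{0..1}. fst p x \<le> fst q x) \<and> snd p \<le> snd q"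

definition dec_from :: "(nat \<Rightarrow> real \<Rightarrow> real) \<Rightarrow> (nat \<Rightarrow> real) \<Rightarrow> nat \<Rightarrow> bool" where
  "dec_from h \<beta> N \<longleftrightarrow> (\<forall>n\<ge>N. pair_le (h (n + 1), \<beta> (n + 1)) (h n, \<beta> n))"

definition Gamma_dec_ev :: "(nat \<Rightarrow> real) \<Rightarrow> ((nat \<Rightarrow> real \<Rightarrow> real) \<times> (nat \<Rightarrow> real)) set" where
  "Gamma_dec_ev u = {(h, \<beta>). (h, \<beta>) \<in> Gamma u \<and> (\<exists>N. dec_from h \<beta> N)}"

definition m_rank :: "(nat \<Rightarrow> real \<Rightarrow> real) \<Rightarrow> (nat \<Rightarrow> real) \<Rightarrow> nat" where
  "m_rank h \<beta> = (LEAST N. dec_from h \<beta> N)"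

definition F_bound :: "(nat \<Rightarrow> real) \<Rightarrow> nat \<Rightarrow> (nat \<Rightarrow> real \<Rightarrow> real) \<Rightarrow> (nat \<Rightarrow> real) \<Rightarrow> ereal" where
  "F_bound u k h \<beta> =
     (if (h, \<beta>) \<in> Gamma u \<and> u k > h k 0
      then ereal (ln (Omega_inv (h k) (u k)) / ln (\<beta> k)) else \<infinity>)"

end

(* Lower bound: put x = h_k^{-1}(u_k), for k in S(u,h) beyond the rank m(h,beta), and
   F = ln x / ln beta_k.  For every n > F one has beta_k^n < x, hence, the sequence (h, beta)
   being decreasing from k on, u_n <= h_n(beta_n^n) <= h_k(beta_k^n) < h_k(x) = u_k.  So the
   integer part of F belongs to Delta.
   Attainment: if K = min Delta, then u_K is a maximum of u and exceeds s = sup_{j>K} u_j.  The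
   constant sequence h_n(x) = s + (u_K - s) 2^K x, beta_n = 1/2, lies in Gamma and yields
   F = K at k = K.
   The inner infima are attained because x <= beta_k^k makes the bound at index k at least k. *)

theory Submission imports Defs begin

section \<open>Inverses on [0,1] and eventually decreasing pairs\<close>

text \<open>The intermediate value theorem on [0,b] produces a preimage of \<open>y\<close>, and
  injectivity on [0,1] identifies it with \<open>Omega_inv f y\<close>. Locating the preimage in
  [0,b] rather than in [0,1] is what later gives x <= beta_k^k.\<close>

lemma Omega_inv_props:
  assumes "f \<in> Omega" "f 0 < y" "y \<le> f b" "0 \<le> b" "b \<le> 1"
  shows "0 < Omega_inv f y" "Omega_inv f y \<le> b" "f (Omega_inv f y) = y"
proof -
  have sm: "strict_mono_on {0..1} f" and cont: "continuous_on {0..1} f"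
    using assms(1) by (auto simp: Omega_def)
  have "continuous_on {0..b} f"
    using continuous_on_subset[OF cont] assms(5) by auto
  then obtain x where x: "0 \<le> x" "x \<le> b" "f x = y"
    using IVT'[of f 0 y b] assms by auto
  have "inj_on f {0..1}"
    using sm by (rule strict_mono_on_imp_inj_on)
  then have inv: "Omega_inv f y = x"
    unfolding Omega_inv_def using x assms(5) by (intro the_inv_into_f_eq) auto
  have "x \<noteq> 0"
    using x(3) assms(2) by auto
  then show "0 < Omega_inv f y" "Omega_inv f y \<le> b" "f (Omega_inv f y) = y"
    using inv x by auto
qed

lemma dec_from_le:
  assumes "dec_from h \<beta> N" "N \<le> k" "k \<le> n"
  shows "\<beta> n \<le> \<beta> k" "\<And>x. x \<in> {0..1} \<Longrightarrow> h n x \<le> h k x"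
proof -
  have "\<beta> n \<le> \<beta> k \<and> (\<forall>x\<in>{0..1}. h n x \<le> h k x)"
    using assms(3)
  proof (induction n rule: dec_induct)
    case (step n)
    have "pair_le (h (n + 1), \<beta> (n + 1)) (h n, \<beta> n)"
      using assms(1,2) step(1) by (auto simp: dec_from_def)
    then show ?case
      using step(3) by (simp add: pair_le_def) (meson order_trans)
  qed simp
  then show "\<beta> n \<le> \<beta> k" "\<And>x. x \<in> {0..1} \<Longrightarrow> h n x \<le> h k x"
    by auto
qed

lemma dec_from_m_rank:
  assumes "(h, \<beta>) \<in> Gamma_dec_ev u"
  shows "dec_from h \<beta> (m_rank h \<beta>)"
  using assms unfolding Gamma_dec_ev_def m_rank_def by (auto intro: LeastI)

section \<open>The lower bound for the upper bound functional\<close>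

text \<open>Take logarithms in x <= beta_k^k and divide by the negative number ln beta_k, which
  reverses the inequality. This serves both to place \<open>k\<close> below the integer part of the
  bound and to make the inner infima attained.\<close>

lemma bound_ge_index:
  assumes "(h, \<beta>) \<in> Gamma u" "k \<in> Sset u h"
  shows "real k \<le> ln (Omega_inv (h k) (u k)) / ln (\<beta> k)"
proof -
  have hk: "h k \<in> Omega" and b: "0 < \<beta> k" "\<beta> k < 1" and le: "u k \<le> h k (\<beta> k ^ k)"
    using assms(1) by (auto simp: Gamma_def)
  let ?x = "Omega_inv (h k) (u k)"
  have "0 < ?x" "?x \<le> \<beta> k ^ k"
    using Omega_inv_props[OF hk _ le] assms(2) b by (auto simp: Sset_def power_le_one)
  then have "ln ?x \<le> real k * ln (\<beta> k)"
    using b by (metis ln_realpow ln_mono zero_less_power)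
  moreover have "ln (\<beta> k) < 0"
    using b by simp
  ultimately show ?thesis
    by (simp add: le_divide_eq)
qed

text \<open>The constant \<open>c\<close> separates the tail from \<open>u i\<close> uniformly: the
  inequalities u_j < u_i taken one by one would only give a non-strict inequality for the
  supremum.\<close>

lemma Deltas_I:
  assumes "i \<le> N" "\<And>j. N < j \<Longrightarrow> u j \<le> c" "c < u i"
  shows "N \<in> Deltas u"
proof -
  have "(SUP j\<in>{N<..}. ereal (u j)) \<le> ereal c"
    using assms(2) by (auto intro: SUP_least)
  also have "\<dots> < ereal (Max (u ` {0..N}))"
    using assms(1,3) by (auto simp: less_le_trans Max_gr_iff intro!: bexI[of _ i])
  finally show ?thesis
    by (simp add: Deltas_def)
qed

lemma Ks_le_bound:
  assumes "(h, \<beta>) \<in> Gamma_dec_ev u" "k \<in> Sset u h" "m_rank h \<beta> \<le> k"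
  shows "Ks u \<le> ereal (ln (Omega_inv (h k) (u k)) / ln (\<beta> k))"
proof -
  have G: "(h, \<beta>) \<in> Gamma u"
    using assms(1) by (auto simp: Gamma_dec_ev_def)
  have hk: "h k \<in> Omega" and le: "u k \<le> h k (\<beta> k ^ k)"
    and b: "0 < \<beta> n" "\<beta> n < 1" for n
    using G by (auto simp: Gamma_def)
  have sm: "strict_mono_on {0..1} (h k)"
    using hk by (simp add: Omega_def)
  let ?x = "Omega_inv (h k) (u k)"
  let ?F = "ln ?x / ln (\<beta> k)"
  have x: "0 < ?x" "?x \<le> 1" "h k ?x = u k"
  proof -
    have "\<beta> k ^ k \<le> 1"
      using b by (intro power_le_one) (auto intro: less_imp_le)
    then show "0 < ?x" "?x \<le> 1" "h k ?x = u k"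
      using Omega_inv_props[OF hk _ le] assms(2) b[of k] by (auto simp: Sset_def)
  qed
  have kF: "real k \<le> ?F"
    using bound_ge_index[OF G assms(2)] .
  \<comment> \<open>As \<open>?F\<close> is at least \<open>k\<close>, hence nonnegative,
    \<open>nat\<close> truncates nothing, and N + 1 is the first integer above
    \<open>?F\<close>.\<close>
  define N where "N = nat \<lfloor>?F\<rfloor>"
  have N: "k \<le> N" "real N \<le> ?F" "?F < real (N + 1)"
    using kF unfolding N_def by linarith+
  have "\<beta> k ^ (N + 1) < ?x"
  proof -
    have "real (N + 1) * ln (\<beta> k) < ln ?x"
      using N(3) b[of k] by (simp add: neg_divide_less_eq)
    then have "ln (\<beta> k ^ (N + 1)) < ln ?x"
      using b(1)[of k] by (subst ln_realpow)
    moreover have "0 < \<beta> k ^ (N + 1)"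
      using b(1) by (rule zero_less_power)
    ultimately show ?thesis
      using x(1) by (simp only: ln_less_cancel_iff)
  qed
  then have less: "h k (\<beta> k ^ (N + 1)) < u k"
    using strict_mono_onD[OF sm, of "\<beta> k ^ (N + 1)" ?x] x b(1)[of k] by auto
  \<comment> \<open>Comparing with the fixed exponent N + 1 instead of \<open>n\<close> bounds the
    whole tail by one constant strictly below \<open>u k\<close>, as \<open>Deltas_I\<close>
    requires.\<close>
  have "u n \<le> h k (\<beta> k ^ (N + 1))" if "N < n" for n
  proof -
    have kn: "k \<le> n"
      using that N(1) by simp
    note dec = dec_from_le[OF dec_from_m_rank[OF assms(1)] assms(3) kn]
    have p01: "\<beta> i ^ j \<in> {0..1}" for i j
      using b[of i] by (auto intro: power_le_one)
    have "\<beta> n ^ n \<le> \<beta> k ^ n"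
      using dec(1) b[of n] by (intro power_mono) auto
    also have "\<dots> \<le> \<beta> k ^ (N + 1)"
      using that b[of k] by (intro power_decreasing) auto
    finally have pw: "\<beta> n ^ n \<le> \<beta> k ^ (N + 1)" .
    have "u n \<le> h n (\<beta> n ^ n)"
      using G by (auto simp: Gamma_def)
    also have "\<dots> \<le> h k (\<beta> n ^ n)"
      using dec(2) p01 .
    also have "\<dots> \<le> h k (\<beta> k ^ (N + 1))"
      using mono_onD[OF strict_mono_on_imp_mono_on[OF sm] p01 p01 pw] .
    finally show ?thesis .
  qed
  then have "N \<in> Deltas u"
    using Deltas_I[OF N(1)] less by blast
  then have "Ks u \<le> ereal (real N)"
    unfolding Ks_def by (rule INF_lower)
  also have "\<dots> \<le> ereal ?F"
    using N(2) by simp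
  finally show ?thesis .
qed

lemma F_bound_eq:
  assumes "(h, \<beta>) \<in> Gamma_dec_ev u" "k \<in> Sset u h"
  shows "F_bound u k h \<beta> = ereal (ln (Omega_inv (h k) (u k)) / ln (\<beta> k))"
  using assms by (auto simp: F_bound_def Gamma_dec_ev_def Sset_def)

section \<open>The least element of \<open>Deltas u\<close> and attainment of the double
  infimum\<close>

text \<open>A real \<open>c\<close> strictly between the limsup and \<open>u k\<close> eventually
  dominates the sequence; any index past both \<open>k\<close> and that threshold then lies in
  \<open>Deltas u\<close>.\<close>

lemma Deltas_nonempty_of_Rs:
  assumes "Rs u \<noteq> {}"
  shows "Deltas u \<noteq> {}"
proof -
  obtain k where "limsup (\<lambda>n. ereal (u n)) < ereal (u k)"
    using assms by (auto simp: Rs_def)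
  then obtain c where c: "limsup (\<lambda>n. ereal (u n)) < ereal c" "c < u k"
    using ereal_dense2 by (metis less_ereal.simps(1))
  have "eventually (\<lambda>n. ereal (u n) < ereal c) sequentially"
    using c(1) by (rule Limsup_lessD)
  then obtain N where "\<And>n. n \<ge> N \<Longrightarrow> u n < c"
    by (auto simp: eventually_sequentially)
  then have "max k N \<in> Deltas u"
    using c(2) by (intro Deltas_I[of k _ _ c]) (auto intro: less_imp_le)
  then show ?thesis
    by auto
qed

lemma Ks_eq_Least:
  assumes "Deltas u \<noteq> {}"
  shows "Ks u = ereal (real (LEAST k. k \<in> Deltas u))"
  unfolding Ks_def
proof (intro antisym INF_lower INF_greatest)
  show "(LEAST k. k \<in> Deltas u) \<in> Deltas u"
    using assms by (auto intro: LeastI)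
qed (auto intro: Least_le)

text \<open>Supplies the data for the extremal pair in \<open>Ks_attained\<close>: minimality of
  \<open>K\<close> forces the maximum of the initial segment to be reached at \<open>K\<close>
  itself.\<close>

lemma Least_Deltas_is_max:
  assumes "Deltas u \<noteq> {}"
  defines "K \<equiv> LEAST k. k \<in> Deltas u"
  obtains s where "\<And>j. j \<le> K \<Longrightarrow> u j \<le> u K" "\<And>j. K < j \<Longrightarrow> u j \<le> s" "s < u K"
proof -
  have "K \<in> Deltas u"
    using assms by (auto intro: LeastI)
  then have D: "(SUP j\<in>{K<..}. ereal (u j)) < ereal (Max (u ` {0..K}))"
    by (simp add: Deltas_def)
  have "Max (u ` {0..K}) \<in> u ` {0..K}"
    by (intro Max_in) auto
  then obtain i where i: "i \<le> K" "u i = Max (u ` {0..K})"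
    by (metis atLeastAtMost_iff imageE)
  have max: "u j \<le> u i" if "j \<le> K" for j
    using that i(2) by auto
  \<comment> \<open>Any real bound of the tail below the maximum can play the role of the supremum;
    a strict intermediate value is immediately real, with no conversion from
    \<open>ereal\<close>.\<close>
  obtain s where s: "(SUP j\<in>{K<..}. ereal (u j)) < ereal s" "s < u i"
    using D ereal_dense2 i(2) by (metis less_ereal.simps(1))
  have sup: "u j \<le> s" if "K < j" for j
    using s(1) SUP_upper[of j "{K<..}" "\<lambda>j. ereal (u j)"] that
    by (metis ereal_less_eq(3) greaterThan_iff less_imp_le order_trans)
  \<comment> \<open>Otherwise the maximum is attained strictly before \<open>K\<close>, so \<open>K - 1\<close> is in \<open>Deltas u\<close>.\<close>
  have "u K = u i"
  proof (rule ccontr)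
    assume "u K \<noteq> u i"
    then have lt: "u K < u i" "i \<noteq> K"
      using max[of K] by auto
    \<comment> \<open>The index \<open>i\<close> lies strictly below \<open>K\<close>, so
      \<open>K\<close> is positive and the subtraction is genuine.\<close>
    then have iK: "i \<le> K - 1" "K - 1 < K"
      using i(1) by auto
    \<comment> \<open>The tail after K - 1 gains only the term \<open>u K\<close>, which is also
      below \<open>u i\<close>.\<close>
    have "u j \<le> max (u K) s" if "K - 1 < j" for j
      using sup[of j] that by (cases "j = K") (auto simp: le_max_iff_disj)
    then have "K - 1 \<in> Deltas u"
      using lt(1) s(2) iK(1) by (intro Deltas_I[of i _ _ "max (u K) s"]) auto
    then show False
      using iK(2) not_less_Least unfolding K_def by blast
  qed
  then show thesis
    using that[of s] max sup s(2) by auto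
qed

lemma Ks_attained:
  assumes "Deltas u \<noteq> {}"
  obtains h \<beta> k where "(h, \<beta>) \<in> Gamma_dec_ev u" "k \<in> Sset u h" "m_rank h \<beta> \<le> k"
    "Ks u = ereal (ln (Omega_inv (h k) (u k)) / ln (\<beta> k))"
proof -
  define K where "K = (LEAST k. k \<in> Deltas u)"
  obtain s where below: "\<And>j. j \<le> K \<Longrightarrow> u j \<le> u K" and above: "\<And>j. K < j \<Longrightarrow> u j \<le> s"
    and s: "s < u K"
    using Least_Deltas_is_max[OF assms] unfolding K_def by metis
  \<comment> \<open>The affine function with value \<open>s\<close> at 0 and \<open>u K\<close> at
    (1/2)^K; the factor 2^K is chosen so that the inverse at \<open>u K\<close> is the
    \<open>K\<close>-th power of beta = 1/2.\<close>
  define f where "f x = s + (u K - s) * 2 ^ K * x" for x :: real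
  let ?h = "\<lambda>n::nat. f" and ?b = "\<lambda>n::nat. 1 / 2 :: real"
  have "f x < f y" if "x < y" for x y
    using that s by (auto simp: f_def)
  then have Om: "f \<in> Omega"
    by (auto simp: Omega_def strict_mono_on_def f_def intro!: continuous_intros)
  have fK: "f ((1 / 2) ^ K) = u K"
    by (simp add: f_def power_one_over)
  \<comment> \<open>Up to \<open>K\<close>, the maximum u_K = f((1/2)^K) suffices because (1/2)^n
    decreases in \<open>n\<close>; beyond \<open>K\<close>, the intercept \<open>s\<close> already
    dominates u_n.\<close>
  have "u n \<le> f ((1 / 2) ^ n)" for n
  proof (cases "n \<le> K")
    case True
    then have "u n \<le> f ((1 / 2) ^ K)"
      using below fK by simp
    also have "\<dots> \<le> f ((1 / 2) ^ n)"
      using True s unfolding f_def by (intro add_left_mono mult_left_mono power_decreasing) auto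
    finally show ?thesis .
  next
    case False
    moreover have "s \<le> f ((1 / 2) ^ n)"
      using s by (simp add: f_def)
    ultimately show ?thesis
      using above[of n] by simp
  qed
  then have G: "(?h, ?b) \<in> Gamma u"
    using Om by (auto simp: Gamma_def)
  have dec: "dec_from ?h ?b 0"
    by (simp add: dec_from_def pair_le_def)
  then have Gd: "(?h, ?b) \<in> Gamma_dec_ev u"
    using G by (auto simp: Gamma_dec_ev_def)
  have rank: "m_rank ?h ?b \<le> K"
    using Least_le[of "dec_from ?h ?b", OF dec] by (simp add: m_rank_def)
  have S: "K \<in> Sset u ?h"
    using s by (simp add: Sset_def f_def)
  have "Omega_inv f (u K) = (1 / 2) ^ K"
    unfolding Omega_inv_def
    using Om fK by (intro the_inv_into_f_eq)
      (auto simp: Omega_def strict_mono_on_imp_inj_on power_le_one)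
  then have "ln (Omega_inv f (u K)) / ln (1 / 2) = real K"
    by (simp add: ln_realpow)
  then have "Ks u = ereal (ln (Omega_inv f (u K)) / ln (1 / 2))"
    using Ks_eq_Least[OF assms] by (simp add: K_def)
  then show thesis
    using that[OF Gd S rank] by simp
qed

section \<open>Attainment of the inner infima\<close>

text \<open>The growth condition makes sublevel sets finite: f j <= f i forces j <= f i. A minimum
  over the sublevel set of one chosen \<open>i\<close> is a minimum over \<open>A\<close>, since
  every other value exceeds \<open>f i\<close>.\<close>

lemma INF_attained_of_ge_index:
  fixes f :: "nat \<Rightarrow> real"
  assumes "A \<noteq> {}" "\<And>i. i \<in> A \<Longrightarrow> real i \<le> f i"
  shows "\<exists>k\<in>A. ereal (f k) = (INF i\<in>A. ereal (f i))"
proof -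
  obtain i where i: "i \<in> A"
    using assms(1) by auto
  define B where "B = {j \<in> A. f j \<le> f i}"
  have "B \<subseteq> {..nat \<lfloor>f i\<rfloor>}"
    using assms(2) by (fastforce simp: B_def le_nat_floor)
  then have fin: "finite B"
    by (rule finite_subset) simp
  have iB: "i \<in> B"
    using i by (simp add: B_def)
  obtain k where k: "k \<in> B" "\<And>j. j \<in> B \<Longrightarrow> f k \<le> f j"
    using ex_min_if_finite[of "f ` B"] fin iB by fastforce
  have "f k \<le> f j" if "j \<in> A" for j
    using k(2)[of j] k(2)[OF iB] that by (cases "j \<in> B") (auto simp: B_def)
  then have "ereal (f k) = (INF i\<in>A. ereal (f i))"
    using k(1) by (intro antisym INF_greatest INF_lower) (auto simp: B_def)
  then show ?thesis
    using k(1) by (auto simp: B_def)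
qed

section \<open>The formula for \<open>Ks u\<close> and its form with minima\<close>

text \<open>Replacing inf by min is expressed at both levels: some pair and index realise the double
  infimum, and every inner infimum over a nonempty index set is attained. An empty index set
  contributes +infinity and has no minimizing index.\<close>

theorem theorem4:
  fixes u :: "nat \<Rightarrow> real"
  shows
    "Ks u = (INF (h, \<beta>)\<in>Gamma_dec_ev u. INF k\<in>{k \<in> Sset u h. k \<ge> m_rank h \<beta>}. F_bound u k h \<beta>)
   \<and> Ks u = (INF (h, \<beta>)\<in>Gamma_dec_ev u. INF k\<in>{k \<in> Sset u h. k \<ge> m_rank h \<beta>}.
               ereal (ln (Omega_inv (h k) (u k)) / ln (\<beta> k)))
   \<and> (Rs u \<noteq> {} \<longrightarrow>
        (\<exists>(h, \<beta>)\<in>Gamma_dec_ev u. \<exists>k\<in>{k \<in> Sset u h. k \<ge> m_rank h \<beta>}.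
            Ks u = F_bound u k h \<beta>
          \<and> Ks u = ereal (ln (Omega_inv (h k) (u k)) / ln (\<beta> k)))
      \<and> (\<forall>(h, \<beta>)\<in>Gamma_dec_ev u. {k \<in> Sset u h. k \<ge> m_rank h \<beta>} \<noteq> {} \<longrightarrow>
            (\<exists>k\<in>{k \<in> Sset u h. k \<ge> m_rank h \<beta>}.
               F_bound u k h \<beta> = (INF i\<in>{k \<in> Sset u h. k \<ge> m_rank h \<beta>}. F_bound u i h \<beta>))
          \<and> (\<exists>k\<in>{k \<in> Sset u h. k \<ge> m_rank h \<beta>}.
               ereal (ln (Omega_inv (h k) (u k)) / ln (\<beta> k)) =
               (INF i\<in>{k \<in> Sset u h. k \<ge> m_rank h \<beta>}.
                  ereal (ln (Omega_inv (h i) (u i)) / ln (\<beta> i))))))"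
proof -
  let ?S = "\<lambda>h \<beta>. {k \<in> Sset u h. k \<ge> m_rank h \<beta>}"
  let ?F = "\<lambda>h \<beta> k. ereal (ln (Omega_inv (h k) (u k)) / ln (\<beta> k))"
  have FB: "F_bound u k h \<beta> = ?F h \<beta> k" if "(h, \<beta>) \<in> Gamma_dec_ev u" "k \<in> ?S h \<beta>" for h \<beta> k
    using that F_bound_eq by blast
  have inner: "(INF k\<in>?S h \<beta>. F_bound u k h \<beta>) = (INF k\<in>?S h \<beta>. ?F h \<beta> k)"
    if "(h, \<beta>) \<in> Gamma_dec_ev u" for h \<beta>
    using FB[OF that] by (rule INF_cong[OF refl])
  have outer: "(INF (h, \<beta>)\<in>Gamma_dec_ev u. INF k\<in>?S h \<beta>. F_bound u k h \<beta>)
      = (INF (h, \<beta>)\<in>Gamma_dec_ev u. INF k\<in>?S h \<beta>. ?F h \<beta> k)"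
    using inner by (intro INF_cong) auto
  have main: "Ks u = (INF (h, \<beta>)\<in>Gamma_dec_ev u. INF k\<in>?S h \<beta>. ?F h \<beta> k)"
  proof (rule antisym)
    show "Ks u \<le> (INF (h, \<beta>)\<in>Gamma_dec_ev u. INF k\<in>?S h \<beta>. ?F h \<beta> k)"
      using Ks_le_bound by (fastforce intro!: INF_greatest)
    show "(INF (h, \<beta>)\<in>Gamma_dec_ev u. INF k\<in>?S h \<beta>. ?F h \<beta> k) \<le> Ks u"
    proof (cases "Deltas u = {}")
      \<comment> \<open>Here \<open>Ks u\<close> is the infimum of the empty set, +infinity, which
        bounds everything from above.\<close>
      case True
      then show ?thesis
        by (simp add: Ks_def top_ereal_def)
    next
      case False
      then obtain h \<beta> k where w: "(h, \<beta>) \<in> Gamma_dec_ev u" "k \<in> ?S h \<beta>" "Ks u = ?F h \<beta> k"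
        using Ks_attained by (metis (mono_tags, lifting) mem_Collect_eq)
      have "(INF (h, \<beta>)\<in>Gamma_dec_ev u. INF k\<in>?S h \<beta>. ?F h \<beta> k) \<le> (INF k\<in>?S h \<beta>. ?F h \<beta> k)"
        using w(1) by (rule INF_lower2) simp
      also have "\<dots> \<le> Ks u"
        unfolding w(3) using w(2) by (rule INF_lower)
      finally show ?thesis .
    qed
  qed
  have attained: "\<exists>(h, \<beta>)\<in>Gamma_dec_ev u. \<exists>k\<in>?S h \<beta>. Ks u = F_bound u k h \<beta> \<and> Ks u = ?F h \<beta> k"
    if R: "Rs u \<noteq> {}"
  proof -
    obtain h \<beta> k where w: "(h, \<beta>) \<in> Gamma_dec_ev u" "k \<in> ?S h \<beta>" "Ks u = ?F h \<beta> k"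
      using Ks_attained[OF Deltas_nonempty_of_Rs[OF R]] by (metis (mono_tags, lifting) mem_Collect_eq)
    then show ?thesis
      using FB[OF w(1,2)] by (intro bexI[OF _ w(1)]) auto
  qed
  have inner_attained: "\<exists>k\<in>?S h \<beta>. ?F h \<beta> k = (INF i\<in>?S h \<beta>. ?F h \<beta> i)"
    if "(h, \<beta>) \<in> Gamma_dec_ev u" "?S h \<beta> \<noteq> {}" for h \<beta>
    using that bound_ge_index by (intro INF_attained_of_ge_index) (auto simp: Gamma_dec_ev_def)
  have inner_attained_F: "\<exists>k\<in>?S h \<beta>. F_bound u k h \<beta> = (INF i\<in>?S h \<beta>. F_bound u i h \<beta>)"
    if G: "(h, \<beta>) \<in> Gamma_dec_ev u" and ne: "?S h \<beta> \<noteq> {}" for h \<beta>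
  proof -
    obtain k where k: "k \<in> ?S h \<beta>" "?F h \<beta> k = (INF i\<in>?S h \<beta>. ?F h \<beta> i)"
      using inner_attained[OF G ne] by blast
    show ?thesis
      by (rule bexI[OF _ k(1)]) (simp only: FB[OF G k(1)] inner[OF G] k(2))
  qed
  show ?thesis
    unfolding outer
    using main attained inner_attained inner_attained_F
    by (intro conjI impI ballI; (assumption | simp only: split_paired_all prod.case; blast))
qed

end
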